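(* Let $\Gamma$ be a locally finite graph, $F$ a field with an absolute value $|\cdot|_{\rm v}$, $\lambda\in F$ and $v\in V(\Gamma)$. Then every set that is minimal with respect to inclusion among the supports containing $v$ of eigenfunctions of $A_{\Gamma,F}$ corresponding to the eigenvalue $\lambda$ is $\Gamma^2$-connected.
   Context: A graph is an undirected graph without loops or multiple edges, with vertex set $V(\Gamma)$; $\Gamma(v)$ is the set of vertices adjacent to $v$. $\Gamma$ is locally finite if every $\Gamma(v)$ is finite (it may be infinite and disconnected). $F^{V(\Gamma)}$ is the $F$-vector space of all functions $V(\Gamma)\to F$, and $A_{\Gamma,F}:F^{V(\Gamma)}\to F^{V(\Gamma)}$ is the linear operator $(A_{\Gamma,F}(f))(v)=\sum_{u\in\Gamma(v)}f(u)$. The absolute value may be trivial. An eigenfunction corresponding to the eigenvalue $\lambda$ is a nonzero $f$ with $A_{\Gamma,F}(f)=\lambda f$. The support of $f$ is $\{u: f(u)\neq 0\}$. $\Gamma^2$ is the graph with vertex set $V(\Gamma)$ in which two distinct vertices are adjacent iff they are joined in $\Gamma$ by a path of length at most $2$. A subset $X\subseteq V(\Gamma)$ is $\Gamma^2$-connected if the subgraph of $\Gamma^2$ induced by $X$ is connected. *)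

theory Defs
  imports Complex_Main "HOL-Library.FuncSet" "Graph_Theory.Digraph_Component"
begin

text \<open>
  A simple undirected graph, possibly infinite and possibly disconnected, is a
  \<^locale>\<open>pair_bidirected_digraph\<close>: every edge is represented by its two opposite arcs,
  there are no loops, and parallel arcs are excluded because arcs are pairs of vertices.
\<close>

definition nbrs :: "'a pair_pre_digraph \<Rightarrow> 'a \<Rightarrow> 'a set" where
  "nbrs G v = {u. (v, u) \<in> parcs G}"

definition locally_finite_graph :: "'a pair_pre_digraph \<Rightarrow> bool" where
  "locally_finite_graph G \<longleftrightarrow> (\<forall>v \<in> pverts G. finite (nbrs G v))"

text \<open>
  The class \<^class>\<open>real_normed_field\<close> is not used for fields with an absolute value: it would
  force the field to be a real algebra, excluding the trivial and p-adic absolute values.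
\<close>

definition absolute_value :: "('f::field \<Rightarrow> real) \<Rightarrow> bool" where
  "absolute_value av \<longleftrightarrow>
     (\<forall>x. av x \<ge> 0) \<and>
     (\<forall>x. av x = 0 \<longleftrightarrow> x = 0) \<and>
     (\<forall>x y. av (x * y) = av x * av y) \<and>
     (\<forall>x y. av (x + y) \<le> av x + av y)"

text \<open>
  A function on the vertex set is represented by a HOL function that is
  \<^const>\<open>extensional\<close> on it, so that equality of HOL functions is equality on the vertex set.
  The zero vector is \<^term>\<open>\<lambda>v\<in>pverts G. 0\<close>.
\<close>

definition vertex_functions :: "'a pair_pre_digraph \<Rightarrow> ('a \<Rightarrow> 'f) set" where
  "vertex_functions G = (pverts G \<rightarrow>\<^sub>E UNIV)"

definition adj_op :: "'a pair_pre_digraph \<Rightarrow> ('a \<Rightarrow> 'f::field) \<Rightarrow> ('a \<Rightarrow> 'f)" where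
  "adj_op G f = (\<lambda>v\<in>pverts G. \<Sum>u\<in>nbrs G v. f u)"

definition eigenfunction :: "'a pair_pre_digraph \<Rightarrow> 'f::field \<Rightarrow> ('a \<Rightarrow> 'f) \<Rightarrow> bool" where
  "eigenfunction G c f \<longleftrightarrow>
     f \<in> vertex_functions G \<and>
     f \<noteq> (\<lambda>v\<in>pverts G. 0) \<and>
     adj_op G f = (\<lambda>v\<in>pverts G. c * f v)"

definition support :: "'a pair_pre_digraph \<Rightarrow> ('a \<Rightarrow> 'f::field) \<Rightarrow> 'a set" where
  "support G f = {u \<in> pverts G. f u \<noteq> 0}"

definition eigen_supports_at :: "'a pair_pre_digraph \<Rightarrow> 'f::field \<Rightarrow> 'a \<Rightarrow> 'a set set" where
  "eigen_supports_at G c v = {support G f | f. eigenfunction G c f \<and> v \<in> support G f}"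

definition minimal_wrt_inclusion :: "'a set set \<Rightarrow> 'a set \<Rightarrow> bool" where
  "minimal_wrt_inclusion \<F> X \<longleftrightarrow> X \<in> \<F> \<and> (\<forall>Y \<in> \<F>. Y \<subseteq> X \<longrightarrow> Y = X)"

definition graph_square :: "'a pair_pre_digraph \<Rightarrow> 'a pair_pre_digraph" where
  "graph_square G =
     \<lparr> pverts = pverts G,
       parcs = {(u, w). u \<in> pverts G \<and> w \<in> pverts G \<and> u \<noteq> w \<and>
                  (\<exists>p. pre_digraph.apath (with_proj G) u p w \<and> length p \<le> 2)} \<rparr>"

text \<open>
  The name \<open>connected\<close> is qualified because it also denotes topological connectedness.
\<close>

definition square_connected :: "'a pair_pre_digraph \<Rightarrow> 'a set \<Rightarrow> bool" where
  "square_connected G X \<longleftrightarrow>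
     X \<subseteq> pverts G \<and> Digraph_Component.connected (with_proj (graph_square G) \<restriction> X)"

end

theory Submission
  imports Defs
begin

text \<open>
  The eigenvalue equation at a vertex \<open>w\<close> only involves the values of the function on the closed
  neighbourhood of \<open>w\<close>, and any two distinct vertices of a closed neighbourhood are adjacent in
  \<open>\<Gamma>\<^sup>2\<close>. Hence, if \<open>f\<close> is an eigenfunction and \<open>C\<close> is a connected component of its support in
  \<open>\<Gamma>\<^sup>2\<close>, no closed neighbourhood meets both \<open>C\<close> and the rest of the support: on each closed
  neighbourhood, the function that agrees with \<open>f\<close> on \<open>C\<close> and vanishes elsewhere is either \<open>f\<close> or \<open>0\<close>
  (\<open>eigenfunction_restrict\<close>). It therefore satisfies the eigenvalue equation everywhere. If \<open>C\<close>
  is the component of \<open>v\<close>, then \<open>C\<close> is itself the support of an eigenfunction and contains \<open>v\<close>,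
  so minimality of the support of \<open>f\<close> makes \<open>C\<close> the whole support.
\<close>

text \<open>
  Two vertices of a closed neighbourhood are joined by a path through its centre \<open>w\<close>; the
  path has a single arc if one of them is the centre itself.
\<close>

lemma graph_square_closed_nbrs:
  assumes "pair_bidirected_digraph G"
    and "x \<in> insert w (nbrs G w)" and "y \<in> insert w (nbrs G w)" and "x \<noteq> y"
  shows "(x, y) \<in> parcs (graph_square G)"
proof -
  interpret pair_bidirected_digraph G by fact
  have noloop: "\<not> (a, a) \<in> parcs G" for a
    using pair_no_loops by force
  have one: "apath a [(a, b)] b" if "(a, b) \<in> parcs G" for a b
    using that noloop by (auto simp: apath_simps dest: in_arcsD2)
  have two: "apath a [(a, b), (b, d)] d"
    if "(a, b) \<in> parcs G" "(b, d) \<in> parcs G" "a \<noteq> d" for a b d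
    using that noloop by (auto simp: apath_simps dest: in_arcsD2)
  consider "x = w" "(x, y) \<in> parcs G" | "y = w" "(x, y) \<in> parcs G"
    | "(x, w) \<in> parcs G" "(w, y) \<in> parcs G"
    using assms(2-4) arcs_symmetric by (auto simp: nbrs_def)
  then have "\<exists>p. apath x p y \<and> length p \<le> 2"
  proof cases
    case 1
    then show ?thesis using one by force
  next
    case 2
    then show ?thesis using one by force
  next
    case 3
    then show ?thesis using two[OF 3 \<open>x \<noteq> y\<close>] by force
  qed
  moreover have "x \<in> pverts G" "y \<in> pverts G"
    using assms(2-4) by (auto simp: nbrs_def dest: in_arcsD1 in_arcsD2)
  ultimately show ?thesis
    using \<open>x \<noteq> y\<close> by (simp add: graph_square_def)
qed

text \<open>
  Restricting an eigenfunction to a union of \<open>\<Gamma>\<^sup>2\<close>-components of its support is harmless, since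
  every instance of the eigenvalue equation either keeps all of its terms or loses all of them.
\<close>

lemma eigenfunction_restrict:
  assumes G: "pair_bidirected_digraph G" and f: "eigenfunction G c f"
    and C: "C \<subseteq> support G f" "C \<noteq> {}"
    and closed: "\<And>x y. x \<in> C \<Longrightarrow> y \<in> support G f \<Longrightarrow> (x, y) \<in> parcs (graph_square G) \<Longrightarrow> y \<in> C"
  defines "g \<equiv> \<lambda>x\<in>pverts G. if x \<in> C then f x else 0"
  shows "eigenfunction G c g" and "support G g = C"
proof -
  interpret pair_bidirected_digraph G by fact
  show supp: "support G g = C"
    using C(1) by (auto simp: support_def g_def)
  have "(\<Sum>u\<in>nbrs G w. g u) = c * g w" if w: "w \<in> pverts G" for w
  proof -
    define N where "N = insert w (nbrs G w)"
    have N: "N \<subseteq> pverts G"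
      using w by (auto simp: N_def nbrs_def dest: in_arcsD2)
    have eig: "(\<Sum>u\<in>nbrs G w. f u) = c * f w"
      using f w by (auto simp: eigenfunction_def adj_op_def dest: fun_cong[where x = w])
    show ?thesis
    proof (cases "N \<inter> C = {}")
      case True
      then have "g x = 0" if "x \<in> N" for x
        using that N by (auto simp: g_def)
      then show ?thesis by (simp add: N_def)
    next
      case False
      then obtain x where x: "x \<in> N" "x \<in> C" by blast
      have "y \<in> C" if "y \<in> N" "y \<in> support G f" for y
        using closed[OF x(2) that(2)] graph_square_closed_nbrs[OF G] x that(1)
        unfolding N_def by metis
      then have "g y = f y" if "y \<in> N" for y
        using that N by (auto simp: g_def support_def)
      then have "(\<Sum>u\<in>nbrs G w. g u) = (\<Sum>u\<in>nbrs G w. f u)" "g w = f w"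
        by (auto simp: N_def intro!: sum.cong)
      then show ?thesis using eig by simp
    qed
  qed
  then have "adj_op G g = (\<lambda>w\<in>pverts G. c * g w)"
    by (auto simp: adj_op_def)
  moreover have "g \<noteq> (\<lambda>w\<in>pverts G. 0)"
    using supp C(2) by (auto simp: support_def)
  moreover have "g \<in> vertex_functions G"
    by (simp add: g_def vertex_functions_def)
  ultimately show "eigenfunction G c g"
    by (simp add: eigenfunction_def)
qed

theorem mainTheorem11:
  fixes G :: "'a pair_pre_digraph"
    and av :: "'f::field \<Rightarrow> real"
    and c :: 'f
    and v :: 'a
    and X :: "'a set"
  assumes "pair_bidirected_digraph G"
    and "locally_finite_graph G"
    and "absolute_value av"
    and "v \<in> pverts G"
    and "minimal_wrt_inclusion (eigen_supports_at G c v) X"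
  shows "square_connected G X"
proof -
  have min: "Y = X" if "Y \<in> eigen_supports_at G c v" "Y \<subseteq> X" for Y
    using assms(5) that by (auto simp: minimal_wrt_inclusion_def)
  obtain f where f: "eigenfunction G c f" and X: "X = support G f" and v: "v \<in> X"
    using assms(5) by (auto simp: minimal_wrt_inclusion_def eigen_supports_at_def)
  define S where "S = with_proj (graph_square G) \<restriction> X"
  define H where "H = mk_symmetric S"
  have "wf_digraph (with_proj (graph_square G))"
    by unfold_locales (auto simp: graph_square_def)
  then interpret S: wf_digraph S
    unfolding S_def by (rule wf_digraph.wellformed_induce_subgraph)
  interpret H: pair_wf_digraph H
    unfolding H_def by (rule S.wellformed_mk_symmetric)
  have verts: "verts S = X" "pverts H = X"
    by (simp_all add: S_def H_def)
  have arc: "(x, y) \<in> parcs H" if "x \<in> X" "y \<in> X" "(x, y) \<in> parcs (graph_square G)" for x y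
    using that by (force simp: H_def S_def parcs_mk_symmetric)
  define C where "C = {x. v \<rightarrow>\<^sup>*\<^bsub>with_proj H\<^esub> x}"
  have CX: "C \<subseteq> X"
    using H.reachable_in_verts(2) verts by (auto simp: C_def)
  have vC: "v \<in> C"
    using v verts by (simp add: C_def)
  have closed: "y \<in> C" if "x \<in> C" "y \<in> support G f" "(x, y) \<in> parcs (graph_square G)" for x y
    using that CX arc H.reachable_adj_trans[of v x y] unfolding C_def X by auto
  define g where "g = (\<lambda>x\<in>pverts G. if x \<in> C then f x else 0)"
  have "eigenfunction G c g" "support G g = C"
    unfolding g_def
    using eigenfunction_restrict[OF assms(1) f, of C] CX vC closed by (auto simp: X)
  then have "C = X"
    using min[OF _ CX] vC by (auto simp: eigen_supports_at_def)
  have "symmetric (with_proj H)"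
    unfolding H_def by (rule symmetric_mk_symmetric)
  then have "x \<rightarrow>\<^sup>*\<^bsub>with_proj H\<^esub> y" if "x \<in> X" "y \<in> X" for x y
    using that \<open>C = X\<close> H.reachable_trans[of x v y] symmetric_reachable[of "with_proj H" v x]
    by (auto simp: C_def)
  then have "Digraph_Component.connected S"
    using v verts by (intro S.connectedI) (auto simp: H_def)
  then show ?thesis
    by (auto simp: square_connected_def S_def X support_def)
qed

end
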